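(* For $i=1,2$, let $\mu_i$ be a probability measure on $\mathbb{R}^{n}$ and let $w_i:\mathbb{R}^{n}\to[0,\infty)$ be a measurable function such that the couple $(\mu_i,w_i)$ satisfies Property $(\tau)$ on $\mathbb{R}^{n}$. Then the couple $(\mu_1*\mu_2,\; w_1\,\square\, w_2)$ satisfies Property $(\tau)$ on $\mathbb{R}^n$, where $\mu_1*\mu_2$ is the convolution of $\mu_1$ and $\mu_2$.
   Context: Measures on $\mathbb{R}^n$ are Borel and "measurable" means Borel measurable; integrals are taken with respect to the completion of the measure (inf-convolutions of Borel functions, including iterated ones such as $\varphi\,\square\,(w_1\,\square\, w_2)$, are measurable for the completion). For functions $f,g$ on $\mathbb{R}^n$, the inf-convolution is $(f\,\square\, g)(x)=\inf\{f(x-y)+g(y): y\in\mathbb{R}^n\}$. Property $(\tau)$: if $\mu$ is a probability measure on $\mathbb{R}^n$ and $w\ge 0$ a measurable function on $\mathbb{R}^n$ (here also allowed: $w=w_1\,\square\, w_2$ with $w_1,w_2\ge0$ Borel), the couple $(\mu,w)$ satisfies Property $(\tau)$ if for every bounded measurable function $\varphi:\mathbb{R}^n\to\mathbb{R}$, $$\Big(\int e^{\varphi\,\square\, w}\,d\mu\Big)\Big(\int e^{-\varphi}\,d\mu\Big)\le 1 .$$ *)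

theory Defs
  imports "HOL-Probability.Probability"
begin

text \<open>
  The infimum is the one of \<^typ>\<open>real\<close>, so it is meaningful only when
  the family \<open>f (x - y) + g y\<close> is bounded below. This holds wherever the operation is
  used here: each argument is either nonnegative or a bounded function.
\<close>

definition inf_conv :: "('a::group_add \<Rightarrow> real) \<Rightarrow> ('a \<Rightarrow> real) \<Rightarrow> 'a \<Rightarrow> real"
    (infixl "\<box>" 70)
  where "(f \<box> g) x = (INF y. f (x - y) + g y)"

text \<open>
  Property \<open>(\<tau>)\<close> for a Borel probability measure \<open>\<mu>\<close> and a nonnegative cost \<open>w\<close>.
  The function \<open>\<phi> \<box> w\<close> need not be Borel, but for \<open>w\<close> Borel, or an inf-convolution of
  nonnegative Borel functions, it is measurable for the completion of \<open>\<mu>\<close>, so the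
  nonnegative integral below is its usual integral. (The measurability is not needed to
  write the integral: in general it is the supremum of the integrals of simple functions below
  the integrand. The Bochner integral would be 0 on a function that is not measurable.)
\<close>

definition property_tau :: "(real ^ 'n) measure \<Rightarrow> (real ^ 'n \<Rightarrow> real) \<Rightarrow> bool"
  where "property_tau \<mu> w \<longleftrightarrow>
    (\<forall>\<phi> :: real ^ 'n \<Rightarrow> real. \<phi> \<in> borel_measurable borel \<longrightarrow> bounded (range \<phi>) \<longrightarrow>
      (\<integral>\<^sup>+ x. ennreal (exp ((\<phi> \<box> w) x)) \<partial>completion \<mu>) *
      (\<integral>\<^sup>+ x. ennreal (exp (- \<phi> x)) \<partial>completion \<mu>) \<le> 1)"

end

theory Submission
  imports Defs
begin

text \<open>
  For a bounded \<open>\<phi>\<close> put \<open>\<psi> z = - ln (\<integral> exp (- \<phi> (z + y)) d\<mu>\<^sub>2 y)\<close>, so that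
  \<open>\<integral> exp (- \<psi>) d\<mu>\<^sub>1 = \<integral> exp (- \<phi>) d(\<mu>\<^sub>1 \<star> \<mu>\<^sub>2)\<close>. Property \<open>(\<tau>)\<close> of \<open>\<mu>\<^sub>2\<close>, applied to the
  translates \<open>y \<mapsto> \<phi> (y + x - z) + w\<^sub>1 z\<close>, and an infimum over \<open>z\<close> bound
  \<open>\<integral> exp ((\<phi> \<box> (w\<^sub>1 \<box> w\<^sub>2)) (x + y)) d\<mu>\<^sub>2 y\<close> by \<open>exp ((\<psi> \<box> w\<^sub>1) x)\<close>. Property \<open>(\<tau>)\<close> of \<open>\<mu>\<^sub>1\<close>,
  applied to \<open>\<psi>\<close>, concludes. The inf-convolutions need not be Borel, but for lower integrals the
  required half of Fubini's theorem holds without measurability.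
\<close>

text \<open>A simple function \<open>g\<close> below \<open>f\<close> is Borel, so Fubini's theorem
  holds for it with equality. Monotonicity of both inner and outer integrals and the supremum over
  \<open>g\<close> then give the bound, with \<open>f\<close> arbitrary.\<close>

lemma nn_integral_convolution_le:
  assumes "finite_measure M" "finite_measure N"
    and "sets N = sets borel" "sets M = sets borel"
  shows "(\<integral>\<^sup>+x. f x \<partial>(M \<star> N)) \<le> (\<integral>\<^sup>+x. \<integral>\<^sup>+y. f (x + y) \<partial>N \<partial>M)"
  unfolding nn_integral_def[of "M \<star> N"]
proof (safe intro!: SUP_least)
  fix g assume g: "simple_function (M \<star> N) g" "g \<le> f"
  have "g \<in> borel_measurable borel"
    using borel_measurable_simple_function[OF g(1)] by simp
  then have "integral\<^sup>S (M \<star> N) g = (\<integral>\<^sup>+x. \<integral>\<^sup>+y. g (x + y) \<partial>N \<partial>M)"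
    using assms g(1) by (simp add: nn_integral_convolution flip: nn_integral_eq_simple_integral)
  also have "\<dots> \<le> (\<integral>\<^sup>+x. \<integral>\<^sup>+y. f (x + y) \<partial>N \<partial>M)"
    using g(2) by (intro nn_integral_mono) (auto simp: le_fun_def)
  finally show "integral\<^sup>S (M \<star> N) g \<le> (\<integral>\<^sup>+x. \<integral>\<^sup>+y. f (x + y) \<partial>N \<partial>M)" .
qed

text \<open>The lower bounds \<open>a\<close> and \<open>b\<close> keep the family bounded below, so
  that its real infimum is a genuine one.\<close>

lemma inf_conv_le:
  assumes "\<And>x. a \<le> f x" "\<And>x. b \<le> g x"
  shows "(f \<box> g) x \<le> f (x - y) + g y"
  unfolding inf_conv_def
  by (rule cINF_lower) (auto intro!: bdd_belowI[of _ "a + b"] add_mono assms)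

lemma inf_conv_greatest:
  assumes "\<And>y. c \<le> f (x - y) + g y"
  shows "c \<le> (f \<box> g) x"
  unfolding inf_conv_def by (rule cINF_greatest) (auto intro: assms)

text \<open>Moves the infimum out of the exponential: for finite \<open>c > 0\<close> take
  logarithms. The case \<open>c = 0\<close> is trivial, and an infinite \<open>c\<close> contradicts
  the hypothesis.\<close>

lemma le_exp_inf_conv:
  assumes le: "\<And>y. c \<le> ennreal (exp (f (x - y) + g y))"
  shows "c \<le> ennreal (exp ((f \<box> g) x))"
proof (cases c)
  case (real r)
  show ?thesis
  proof (cases "r = 0")
    case False
    with real have "r > 0" by simp
    have "ln r \<le> (f \<box> g) x"
    proof (rule inf_conv_greatest)
      fix y
      have "r \<le> exp (f (x - y) + g y)"
        using le[of y] real by simp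
      with \<open>r > 0\<close> show "ln r \<le> f (x - y) + g y"
        by (metis ln_exp ln_le_cancel_iff exp_gt_zero)
    qed
    with \<open>r > 0\<close> have "r \<le> exp ((f \<box> g) x)"
      by (metis exp_le_cancel_iff exp_ln)
    with real show ?thesis by simp
  qed (use real in simp)
next
  case top
  with le[of undefined] show ?thesis by (simp add: top_unique)
qed

text \<open>For each \<open>u\<close>, test the outer infimum at \<open>z + u\<close> and the inner
  one at \<open>u\<close>; the argument left for \<open>\<phi>\<close> is
  \<open>(y - u) + (x - z)\<close>.\<close>

lemma inf_conv_assoc_le:
  fixes \<phi> :: "'a::ab_group_add \<Rightarrow> real"
  assumes \<phi>: "\<And>x. a \<le> \<phi> x" and w1: "\<And>x. 0 \<le> w\<^sub>1 x" and w2: "\<And>x. 0 \<le> w\<^sub>2 x"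
  shows "(\<phi> \<box> (w\<^sub>1 \<box> w\<^sub>2)) (x + y) \<le> ((\<lambda>u. \<phi> (u + (x - z)) + w\<^sub>1 z) \<box> w\<^sub>2) y"
proof (rule inf_conv_greatest)
  fix u
  have nonneg: "0 \<le> (w\<^sub>1 \<box> w\<^sub>2) v" for v
    by (intro inf_conv_greatest add_nonneg_nonneg w1 w2)
  have "(\<phi> \<box> (w\<^sub>1 \<box> w\<^sub>2)) (x + y) \<le> \<phi> (x + y - (z + u)) + (w\<^sub>1 \<box> w\<^sub>2) (z + u)"
    by (rule inf_conv_le[OF \<phi> nonneg])
  also have "(w\<^sub>1 \<box> w\<^sub>2) (z + u) \<le> w\<^sub>1 (z + u - u) + w\<^sub>2 u"
    by (rule inf_conv_le[OF w1 w2])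
  finally show "(\<phi> \<box> (w\<^sub>1 \<box> w\<^sub>2)) (x + y) \<le> \<phi> (y - u + (x - z)) + w\<^sub>1 z + w\<^sub>2 u"
    by (simp add: algebra_simps)
qed

lemma property_tauD:
  fixes w :: "real ^ 'n \<Rightarrow> real"
  assumes "property_tau \<mu> w" "\<phi> \<in> borel_measurable borel" "bounded (range \<phi>)"
  shows "(\<integral>\<^sup>+ x. ennreal (exp ((\<phi> \<box> w) x)) \<partial>\<mu>) * (\<integral>\<^sup>+ x. ennreal (exp (- \<phi> x)) \<partial>\<mu>) \<le> 1"
  using assms unfolding property_tau_def nn_integral_completion by blast

theorem lemma2:
  fixes \<mu>\<^sub>1 \<mu>\<^sub>2 :: "(real ^ 'n) measure"
    and w\<^sub>1 w\<^sub>2 :: "real ^ 'n \<Rightarrow> real"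
  assumes "prob_space \<mu>\<^sub>1" and "sets \<mu>\<^sub>1 = sets borel"
    and "prob_space \<mu>\<^sub>2" and "sets \<mu>\<^sub>2 = sets borel"
    and "w\<^sub>1 \<in> borel_measurable borel" and "\<And>x. 0 \<le> w\<^sub>1 x"
    and "w\<^sub>2 \<in> borel_measurable borel" and "\<And>x. 0 \<le> w\<^sub>2 x"
    and "property_tau \<mu>\<^sub>1 w\<^sub>1"
    and "property_tau \<mu>\<^sub>2 w\<^sub>2"
  shows "property_tau (\<mu>\<^sub>1 \<star> \<mu>\<^sub>2) (w\<^sub>1 \<box> w\<^sub>2)"
  unfolding property_tau_def nn_integral_completion
proof (intro allI impI)
  fix \<phi> :: "real ^ 'n \<Rightarrow> real"
  assume \<phi>[measurable]: "\<phi> \<in> borel_measurable borel" and bdd: "bounded (range \<phi>)"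
  interpret M1: prob_space \<mu>\<^sub>1 by fact
  interpret M2: prob_space \<mu>\<^sub>2 by fact
  note [measurable_cong] = assms(2,4)
  obtain B where "\<And>x. \<bar>\<phi> x\<bar> \<le> B"
    using bdd by (auto simp: bounded_iff)
  then have B: "- B \<le> \<phi> x" "\<phi> x \<le> B" for x
    by (auto simp: abs_le_iff minus_le_iff)

  define Z where "Z z = (\<integral>y. exp (- \<phi> (z + y)) \<partial>\<mu>\<^sub>2)" for z
  define \<psi> where "\<psi> z = - ln (Z z)" for z
  have int: "integrable \<mu>\<^sub>2 (\<lambda>y. exp (- \<phi> (z + y)))" for z
    by (rule M2.integrable_const_bound[where B = "exp B"])
      (use B in \<open>auto simp: minus_le_iff\<close>)
  \<comment> \<open>These bounds make the logarithm meaningful and give \<open>\<psi>\<close> the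
    bound \<open>B\<close>, so that \<open>\<psi>\<close> is admissible in Property (\<tau>) of
    \<open>\<mu>\<^sub>1\<close>.\<close>
  have Z_ge: "exp (- B) \<le> Z z" and Z_le: "Z z \<le> exp B" for z
    unfolding Z_def using B
    by (auto intro!: M2.integral_ge_const M2.integral_le_const int simp: minus_le_iff)
  have Z_pos: "0 < Z z" for z
    using Z_ge[of z] exp_gt_zero[of "- B"] by linarith
  have Z_nn: "ennreal (Z z) = (\<integral>\<^sup>+y. ennreal (exp (- \<phi> (z + y))) \<partial>\<mu>\<^sub>2)" for z
    unfolding Z_def by (rule nn_integral_eq_integral[symmetric, OF int]) simp
  have exp_\<psi>: "exp (- \<psi> z) = Z z" for z
    using Z_pos[of z] by (simp add: \<psi>_def)
  have [measurable]: "Z \<in> borel_measurable borel"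
    unfolding Z_def by measurable
  have [measurable]: "\<psi> \<in> borel_measurable borel"
    unfolding \<psi>_def by measurable
  have "\<bar>\<psi> z\<bar> \<le> B" for z
    using Z_ge[of z] Z_le[of z] Z_pos[of z] ln_mono[of "exp (- B)" "Z z"] ln_mono[of "Z z" "exp B"]
    by (auto simp: \<psi>_def abs_le_iff)
  then have "bounded (range \<psi>)"
    by (auto simp: bounded_iff)

  have inner: "(\<integral>\<^sup>+y. ennreal (exp ((\<phi> \<box> (w\<^sub>1 \<box> w\<^sub>2)) (x + y))) \<partial>\<mu>\<^sub>2) \<le> ennreal (exp ((\<psi> \<box> w\<^sub>1) x))"
    (is "?I \<le> _") for x
  proof (rule le_exp_inf_conv)
    fix z
    \<comment> \<open>The summand \<open>w\<^sub>1 z\<close> is constant in \<open>u\<close>: it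
      leaves the integral of \<open>exp (- ?\<phi>)\<close> as a factor, next to
      \<open>Z (x - z)\<close>.\<close>
    let ?\<phi> = "\<lambda>u. \<phi> (u + (x - z)) + w\<^sub>1 z"
    have "\<bar>?\<phi> u\<bar> \<le> B + w\<^sub>1 z" for u
      using B[of "u + (x - z)"] assms(6)[of z] by (auto simp: abs_le_iff)
    then have "bounded (range ?\<phi>)"
      by (auto simp: bounded_iff)
    then have tau: "(\<integral>\<^sup>+ y. ennreal (exp ((?\<phi> \<box> w\<^sub>2) y)) \<partial>\<mu>\<^sub>2) * (\<integral>\<^sup>+ y. ennreal (exp (- ?\<phi> y)) \<partial>\<mu>\<^sub>2) \<le> 1"
      by (intro property_tauD[OF assms(10)]) auto
    have "(\<integral>\<^sup>+ y. ennreal (exp (- ?\<phi> y)) \<partial>\<mu>\<^sub>2) =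
        (\<integral>\<^sup>+ y. ennreal (exp (- w\<^sub>1 z)) * ennreal (exp (- \<phi> ((x - z) + y))) \<partial>\<mu>\<^sub>2)"
      by (intro nn_integral_cong)
        (simp add: ennreal_mult[symmetric] exp_add[symmetric] algebra_simps)
    also have "\<dots> = ennreal (exp (- w\<^sub>1 z)) * ennreal (Z (x - z))"
      unfolding Z_nn by (rule nn_integral_cmult) simp
    also have "\<dots> = ennreal (exp (- (\<psi> (x - z) + w\<^sub>1 z)))"
      by (simp add: ennreal_mult[symmetric] exp_\<psi>[symmetric] exp_add[symmetric])
    finally have eq: "(\<integral>\<^sup>+ y. ennreal (exp (- ?\<phi> y)) \<partial>\<mu>\<^sub>2) = ennreal (exp (- (\<psi> (x - z) + w\<^sub>1 z)))" .
    have "?I \<le> (\<integral>\<^sup>+ y. ennreal (exp ((?\<phi> \<box> w\<^sub>2) y)) \<partial>\<mu>\<^sub>2)" (is "_ \<le> ?J")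
      by (intro nn_integral_mono ennreal_leI exp_le_cancel_iff[THEN iffD2] inf_conv_assoc_le)
        (rule B(1) assms(6,8))+
    \<comment> \<open>Multiplying by a product equal to 1 replaces a division in
      \<open>ennreal\<close>, where \<open>?J\<close> is not yet known to be finite.\<close>
    also have "?J = ?J * (ennreal (exp (- (\<psi> (x - z) + w\<^sub>1 z))) * ennreal (exp (\<psi> (x - z) + w\<^sub>1 z)))"
      by (simp add: ennreal_mult[symmetric] exp_add[symmetric])
    also have "\<dots> \<le> ennreal (exp (\<psi> (x - z) + w\<^sub>1 z))"
      using mult_right_mono[OF tau, of "ennreal (exp (\<psi> (x - z) + w\<^sub>1 z))"]
      unfolding eq by (simp add: mult.assoc)
    finally show "?I \<le> ennreal (exp (\<psi> (x - z) + w\<^sub>1 z))" .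
  qed

  have "(\<integral>\<^sup>+x. ennreal (exp ((\<phi> \<box> (w\<^sub>1 \<box> w\<^sub>2)) x)) \<partial>(\<mu>\<^sub>1 \<star> \<mu>\<^sub>2))
      \<le> (\<integral>\<^sup>+x. \<integral>\<^sup>+y. ennreal (exp ((\<phi> \<box> (w\<^sub>1 \<box> w\<^sub>2)) (x + y))) \<partial>\<mu>\<^sub>2 \<partial>\<mu>\<^sub>1)"
    by (rule nn_integral_convolution_le) (fact M1.finite_measure_axioms M2.finite_measure_axioms assms)+
  also have "\<dots> \<le> (\<integral>\<^sup>+x. ennreal (exp ((\<psi> \<box> w\<^sub>1) x)) \<partial>\<mu>\<^sub>1)"
    by (intro nn_integral_mono inner)
  finally have "(\<integral>\<^sup>+x. ennreal (exp ((\<phi> \<box> (w\<^sub>1 \<box> w\<^sub>2)) x)) \<partial>(\<mu>\<^sub>1 \<star> \<mu>\<^sub>2))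
      \<le> (\<integral>\<^sup>+x. ennreal (exp ((\<psi> \<box> w\<^sub>1) x)) \<partial>\<mu>\<^sub>1)" .
  \<comment> \<open>Here the integrand is Borel, so Fubini's theorem gives an equality.\<close>
  moreover have "(\<integral>\<^sup>+x. ennreal (exp (- \<phi> x)) \<partial>(\<mu>\<^sub>1 \<star> \<mu>\<^sub>2)) = (\<integral>\<^sup>+x. ennreal (exp (- \<psi> x)) \<partial>\<mu>\<^sub>1)"
    unfolding exp_\<psi> Z_nn
    by (rule nn_integral_convolution)
      (simp_all add: M1.finite_measure_axioms M2.finite_measure_axioms assms)
  moreover have "(\<integral>\<^sup>+x. ennreal (exp ((\<psi> \<box> w\<^sub>1) x)) \<partial>\<mu>\<^sub>1) * (\<integral>\<^sup>+x. ennreal (exp (- \<psi> x)) \<partial>\<mu>\<^sub>1) \<le> 1"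
    by (rule property_tauD) (fact assms(9) \<open>\<psi> \<in> borel_measurable borel\<close> \<open>bounded (range \<psi>)\<close>)+
  ultimately show "(\<integral>\<^sup>+x. ennreal (exp ((\<phi> \<box> (w\<^sub>1 \<box> w\<^sub>2)) x)) \<partial>(\<mu>\<^sub>1 \<star> \<mu>\<^sub>2)) *
      (\<integral>\<^sup>+x. ennreal (exp (- \<phi> x)) \<partial>(\<mu>\<^sub>1 \<star> \<mu>\<^sub>2)) \<le> 1"
    by (auto intro: order_trans[OF mult_right_mono])
qed

end
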